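(* Let $\mathcal{H}$ be a separable Hilbert space, let $L\in\mathcal{L}(\mathcal{H})$, and let $\{f_n\}_{n=1}^{\infty}\subset\mathcal{H}$. Then the following statements are equivalent: (i) $\{f_n\}_{n=1}^{\infty}$ is an atomic system for $L$; (ii) there exist constants $A,B>0$ such that $$A\|L^{*}x\|^2\leq \sum_{n=1}^{\infty} |\langle x,f_n\rangle|^2\leq B\|x\|^2\quad\text{for all } x\in\mathcal{H};$$ (iii) $\{f_n\}_{n=1}^{\infty}$ is a Bessel sequence and there exists a Bessel sequence $\{g_n\}_{n=1}^{\infty}\subset\mathcal{H}$ such that $$Lx=\sum_{n=1}^{\infty} \langle x,g_n\rangle f_n\quad\text{for all } x\in\mathcal{H};$$ (iv) $\sum_{n=1}^{\infty}|\langle x,f_n\rangle|^2<\infty$ for all $x\in\mathcal{H}$, and there exists a Bessel sequence $\{g_n\}_{n=1}^{\infty}\subset\mathcal{H}$ such that $$L^*x=\sum_{n=1}^{\infty} \langle x,f_n\rangle g_n\quad\text{for all } x\in\mathcal{H}.$$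
   Context: $\mathcal{L}(\mathcal{H})$ is the space of all bounded linear operators on $\mathcal{H}$; $L^*$ is the Hilbert space adjoint of $L$; the inner product is linear in its first argument; series of vectors converge in the norm of $\mathcal{H}$. A sequence $\{f_n\}_{n=1}^{\infty}\subset\mathcal{H}$ is a Bessel sequence if there is a constant $B>0$ such that $\sum_{n=1}^{\infty}|\langle x,f_n\rangle|^2\leq B\|x\|^2$ for all $x\in\mathcal{H}$. A sequence $\{f_n\}_{n=1}^{\infty}\subset\mathcal{H}$ is an atomic system for $L\in\mathcal{L}(\mathcal{H})$ if: (1) the series $\sum_n c_nf_n$ converges for all $c=(c_n)\in l^2$; and (2) there exists $C>0$ such that for every $x\in\mathcal{H}$ there exists $a_x=(a_n)\in l^2$ with $\|a_x\|_{l^2}\leq C\|x\|$ and $Lx=\sum_n a_nf_n$. *)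

theory Defs
  imports "HOL-Analysis.Analysis"
begin

text \<open>
  The library has only real inner product spaces. To treat real and complex Hilbert spaces
  together, the scalars range over a complete normed field with a conjugation satisfying
  \<open>z * cj z = \<bar>z\<bar>\<^sup>2\<close>; by the Gelfand-Mazur theorem, \<open>real\<close> (with the identity) and \<open>complex\<close>
  (with \<open>cnj\<close>) are the only ones up to isomorphism.
\<close>

class conj_field = real_normed_field + complete_space +
  fixes cj :: "'a \<Rightarrow> 'a"
  assumes cj_add: "cj (z + w) = cj z + cj w"
    and cj_mult: "cj (z * w) = cj z * cj w"
    and mult_cj: "z * cj z = (norm z)\<^sup>2 *\<^sub>R 1"

instantiation real :: conj_field
begin
definition cj_real :: "real \<Rightarrow> real" where "cj_real z = z"
instance by standard (simp_all add: cj_real_def power2_eq_square)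
end

instantiation complex :: conj_field
begin
definition cj_complex :: "complex \<Rightarrow> complex" where "cj_complex z = cnj z"
instance by standard (simp_all add: cj_complex_def complex_norm_square[symmetric] scaleR_conv_of_real)
end

text \<open>
  Completeness is the type class \<open>banach\<close>; \<open>scale_of_real\<close> ties the scalar multiplication to the
  real one that comes with that class.
\<close>

locale hilbert_space = vector_space smul
  for smul :: "'k::conj_field \<Rightarrow> 'a::banach \<Rightarrow> 'a" +
  fixes ip :: "'a \<Rightarrow> 'a \<Rightarrow> 'k"
  assumes scale_of_real: "smul (of_real r) x = r *\<^sub>R x"
    and ip_add_left: "ip (x + y) z = ip x z + ip y z"
    and ip_scale_left: "ip (smul c x) y = c * ip x y"
    and ip_commute: "ip x y = cj (ip y x)"
    and ip_self: "ip x x = of_real ((norm x)\<^sup>2)"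

lemma hilbert_space_real:
  "hilbert_space scaleR (inner :: 'a::{real_inner,banach} \<Rightarrow> 'a \<Rightarrow> real)"
  by unfold_locales
    (auto simp: algebra_simps inner_add_left inner_commute cj_real_def dot_square_norm)

lemma hilbert_space_complex: "hilbert_space (*) (\<lambda>x y::complex. x * cnj y)"
  by unfold_locales
    (auto simp: algebra_simps cj_complex_def scaleR_conv_of_real complex_norm_square[symmetric])

definition bounded_operator :: "('k::conj_field \<Rightarrow> 'a::banach \<Rightarrow> 'a) \<Rightarrow> ('a \<Rightarrow> 'a) \<Rightarrow> bool" where
  "bounded_operator smul L \<longleftrightarrow>
     Vector_Spaces.linear smul smul L \<and> (\<exists>K. \<forall>x. norm (L x) \<le> K * norm x)"

text \<open>
  The adjoint of a bounded operator exists by the Riesz representation theorem, and its defining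
  identity determines it uniquely.
\<close>

definition hilbert_adjoint :: "('a \<Rightarrow> 'a \<Rightarrow> 'k) \<Rightarrow> ('a \<Rightarrow> 'a) \<Rightarrow> 'a \<Rightarrow> 'a" where
  "hilbert_adjoint ip L = (THE M. \<forall>x y. ip (L x) y = ip x (M y))"

definition l2 :: "(nat \<Rightarrow> 'k::conj_field) set" where
  "l2 = {c. summable (\<lambda>n. (norm (c n))\<^sup>2)}"

definition l2_norm :: "(nat \<Rightarrow> 'k::conj_field) \<Rightarrow> real" where
  "l2_norm c = sqrt (\<Sum>n. (norm (c n))\<^sup>2)"

text \<open>
  Since \<open>suminf\<close> is unspecified for divergent series, every bound on a series of squares comes
  with a summability condition.
\<close>

definition bessel_sequence :: "('a::banach \<Rightarrow> 'a \<Rightarrow> 'k::conj_field) \<Rightarrow> (nat \<Rightarrow> 'a) \<Rightarrow> bool" where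
  "bessel_sequence ip f \<longleftrightarrow>
     (\<exists>B>0. \<forall>x. summable (\<lambda>n. (norm (ip x (f n)))\<^sup>2) \<and>
                (\<Sum>n. (norm (ip x (f n)))\<^sup>2) \<le> B * (norm x)\<^sup>2)"

definition atomic_system ::
    "('k::conj_field \<Rightarrow> 'a::banach \<Rightarrow> 'a) \<Rightarrow> ('a \<Rightarrow> 'a) \<Rightarrow> (nat \<Rightarrow> 'a) \<Rightarrow> bool" where
  "atomic_system smul L f \<longleftrightarrow>
     (\<forall>c\<in>l2. summable (\<lambda>n. smul (c n) (f n))) \<and>
     (\<exists>C>0. \<forall>x. \<exists>a\<in>l2. l2_norm a \<le> C * norm x \<and> (\<lambda>n. smul (a n) (f n)) sums L x)"

end

theory Submission
  imports Defs
begin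

text \<open>
  Write \<open>U x = (\<langle>x, f\<^sub>n\<rangle>)\<^sub>n\<close> for the analysis operator of \<open>f\<close> and \<open>T c = \<Sum>\<^sub>n c\<^sub>n f\<^sub>n\<close> for the synthesis
  operator. For a Bessel sequence they are bounded, between the Hilbert space and \<open>\<ell>\<^sup>2\<close>, and adjoint to each
  other. All four statements say that \<open>f\<close> is Bessel and that \<open>L\<close> factors through \<open>T\<close>, that is
  \<open>L = T V\<close> with \<open>V\<close> bounded; they differ in how the factorization is expressed.

  The Bessel property is where uniform boundedness enters: it follows from the mere convergence of
  \<open>\<Sum>\<^sub>n c\<^sub>n f\<^sub>n\<close> for all square summable \<open>c\<close> (\<open>bessel_sequence_if_synthesis_summable\<close>), and also from
  \<open>U x \<in> \<ell>\<^sup>2\<close> for all \<open>x\<close> (\<open>bessel_sequence_if_pointwise\<close>).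

  (i) implies (ii): expanding \<open>L y\<close> for \<open>y = L\<^sup>* x\<close> with coefficients \<open>a\<close>, \<open>\<parallel>a\<parallel> \<le> C \<parallel>y\<parallel>\<close>, gives
  \<open>\<parallel>y\<parallel>\<^sup>2 = \<langle>L y, x\<rangle> = \<langle>a, U x\<rangle> \<le> C \<parallel>y\<parallel> \<parallel>U x\<parallel>\<close>, the lower bound with \<open>A = 1 / C\<^sup>2\<close>.

  (ii) implies (iii) is the substantial step, a case of Douglas' factorization theorem
  (\<open>douglas_factorization\<close>). The lower bound says that \<open>U x \<mapsto> \<langle>x, L y\<rangle>\<close> is a well defined functional on
  the range of \<open>U\<close> of norm at most \<open>\<parallel>y\<parallel> / \<surd>A\<close>. It is therefore represented by a unique vector
  \<open>V y\<close> in the closure of that range, and by uniqueness \<open>V\<close> is linear. Each coordinate of \<open>V\<close> is a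
  bounded functional, hence of the form \<open>(V y)\<^sub>n = \<langle>y, g\<^sub>n\<rangle>\<close>; the \<open>g\<^sub>n\<close> form a Bessel sequence because
  \<open>V\<close> is bounded, and \<open>L = U\<^sup>* V\<close> is the required expansion.

  (iii) and (iv) are adjoint to each other: interchanging \<open>f\<close> and \<open>g\<close> in an expansion yields the
  expansion of the adjoint operator (\<open>adjoint_expansion\<close>). Finally (iii) implies (i) with
  \<open>a\<^sub>x = (\<langle>x, g\<^sub>n\<rangle>)\<^sub>n\<close>.
\<close>

section \<open>Scalars with conjugation\<close>

subclass (in conj_field) banach ..

lemma cj_0 [simp]: "cj (0::'k::conj_field) = 0"
  using cj_add[of 0 "0::'k"] by simp

lemma norm_cj [simp]: "norm (cj z) = norm (z::'k::conj_field)"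
proof (cases "z = 0")
  case False
  have "norm z * norm (cj z) = norm z * norm z"
    using arg_cong[OF mult_cj[of z], of norm] by (simp add: norm_mult power2_eq_square)
  then show ?thesis using False by simp
qed simp

lemma mult_cj_of_real: "z * cj z = of_real ((norm (z::'k::conj_field))\<^sup>2)"
  by (simp add: mult_cj of_real_def)

lemma cj_cj [simp]: "cj (cj z) = (z::'k::conj_field)"
proof (cases "z = 0")
  case False
  have "cj z * cj (cj z) = cj z * z"
    using mult_cj[of z] mult_cj[of "cj z"] by (simp add: mult.commute)
  moreover have "cj z \<noteq> 0" using False norm_cj[of z] by (metis norm_eq_zero)
  ultimately show ?thesis by simp
qed simp

lemma cj_of_real [simp]: "cj (of_real r) = (of_real r :: 'k::conj_field)"
proof (cases "r = 0")
  case False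
  have "of_real r * cj (of_real r) = of_real r * (of_real r :: 'k)"
    using mult_cj_of_real[of "of_real r::'k"] by (simp add: power2_eq_square)
  then show ?thesis using False by simp
qed simp

lemma cj_minus [simp]: "cj (- z) = - cj (z::'k::conj_field)"
  using cj_add[of z "-z"] by (simp add: eq_neg_iff_add_eq_0 add.commute)

lemma cj_diff: "cj (z - w) = cj z - cj (w::'k::conj_field)"
  using cj_add[of z "-w"] by simp

lemma bounded_linear_cj: "bounded_linear (cj :: 'k::conj_field \<Rightarrow> 'k)"
  by (rule bounded_linear_intro[where K=1]) (simp_all add: cj_add cj_mult scaleR_conv_of_real)

section \<open>Geometry of Hilbert spaces\<close>

lemma limit_in_closure: "(\<And>k. w k \<in> S) \<Longrightarrow> w \<longlonglongrightarrow> b \<Longrightarrow> b \<in> closure S"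
  for w :: "nat \<Rightarrow> 'a::first_countable_topology"
  unfolding closure_sequential by blast

context hilbert_space
begin

lemma ip_zero_left [simp]: "ip 0 y = 0"
  using ip_add_left[of 0 0 y] by simp

lemma ip_zero_right [simp]: "ip x 0 = 0"
  by (subst ip_commute) simp

lemma ip_add_right: "ip x (y + z) = ip x y + ip x z"
  by (metis ip_commute ip_add_left cj_add)

lemma ip_scale_right: "ip x (smul c y) = cj c * ip x y"
  by (metis ip_commute ip_scale_left cj_mult)

lemma ip_minus_left: "ip (- x) y = - ip x y"
  using ip_add_left[of x "-x" y] by (simp add: eq_neg_iff_add_eq_0 add.commute)

lemma ip_diff_left: "ip (x - y) z = ip x z - ip y z"
  using ip_add_left[of x "-y" z] by (simp add: ip_minus_left)

lemma ip_diff_right: "ip x (y - z) = ip x y - ip x z"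
  by (metis ip_commute ip_diff_left cj_diff)

lemma norm_smul: "norm (smul c x) = norm c * norm x"
proof -
  have "of_real ((norm (smul c x))\<^sup>2) = (c * cj c) * ip x x"
    unfolding ip_self[symmetric] by (simp add: ip_scale_left ip_scale_right)
  also have "\<dots> = of_real ((norm c * norm x)\<^sup>2)"
    by (simp add: ip_self mult_cj_of_real power_mult_distrib)
  finally have "(norm (smul c x))\<^sup>2 = (norm c * norm x)\<^sup>2"
    by (simp only: of_real_eq_iff)
  then show ?thesis
    by (simp add: power2_eq_iff_nonneg)
qed

text \<open>
  Subtracting from \<open>x\<close> its projection onto the line of \<open>y\<close>. This one identity yields both the
  Cauchy-Schwarz inequality, as the left side is nonnegative, and the orthogonality of vectors
  of minimal norm, as the right side is smaller than \<open>\<parallel>x\<parallel>\<^sup>2\<close> unless \<open>\<langle>x, y\<rangle> = 0\<close>.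
\<close>

lemma norm_diff_projection:
  assumes "y \<noteq> 0"
  shows "(norm (x - smul (ip x y / of_real ((norm y)\<^sup>2)) y))\<^sup>2
         = (norm x)\<^sup>2 - (norm (ip x y))\<^sup>2 / (norm y)\<^sup>2"
proof -
  define n where "n = (norm y)\<^sup>2"
  define t where "t = ip x y / of_real n"
  have n: "n \<noteq> 0" using assms by (simp add: n_def)
  have t: "t * of_real n = ip x y" using n by (simp add: t_def)
  have "of_real ((norm (x - smul t y))\<^sup>2) = ip (x - smul t y) (x - smul t y)"
    by (simp only: ip_self)
  also have "\<dots> = ip x x - cj t * ip x y - t * (ip y x - cj t * ip y y)"
    by (simp add: ip_diff_left ip_diff_right ip_scale_left ip_scale_right algebra_simps)
  also have "ip y y = of_real n" by (simp only: ip_self n_def)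
  also have "ip y x - cj t * of_real n = 0"
    using arg_cong[OF t, of cj] by (simp add: cj_mult ip_commute[of y x])
  also have "ip x x - cj t * ip x y - t * 0 = of_real ((norm x)\<^sup>2) - (ip x y * cj (ip x y)) / of_real n"
  proof -
    have "cj t * of_real n = cj (ip x y)" using arg_cong[OF t, of cj] by (simp add: cj_mult)
    then have "cj t = cj (ip x y) / of_real n" using n by (simp add: field_simps)
    then show ?thesis by (simp add: ip_self)
  qed
  also have "\<dots> = of_real ((norm x)\<^sup>2 - (norm (ip x y))\<^sup>2 / n)"
    by (simp add: mult_cj_of_real)
  finally show ?thesis by (simp only: of_real_eq_iff t_def n_def)
qed

lemma cauchy_schwarz: "norm (ip x y) \<le> norm x * norm y"
proof (cases "y = 0")
  case False
  have "0 \<le> (norm x)\<^sup>2 - (norm (ip x y))\<^sup>2 / (norm y)\<^sup>2"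
    using norm_diff_projection[OF False, of x] by (metis zero_le_power2)
  then have "(norm (ip x y))\<^sup>2 \<le> (norm x * norm y)\<^sup>2"
    using False by (simp add: field_simps power_mult_distrib)
  then show ?thesis by (rule power2_le_imp_le) simp
qed simp

lemma orthogonal_if_norm_minimal:
  assumes "\<And>t. norm x \<le> norm (x - smul t y)"
  shows "ip x y = 0"
proof (cases "y = 0")
  case False
  have "(norm x)\<^sup>2 \<le> (norm x)\<^sup>2 - (norm (ip x y))\<^sup>2 / (norm y)\<^sup>2"
    unfolding norm_diff_projection[OF False, symmetric] using assms by (intro power_mono) simp_all
  then show ?thesis using False by (simp add: divide_le_0_iff)
qed simp

lemma parallelogram:
  fixes x y :: 'a
  shows "(norm (x + y))\<^sup>2 + (norm (x - y))\<^sup>2 = 2 * (norm x)\<^sup>2 + 2 * (norm y)\<^sup>2"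
proof -
  have sq: "of_real ((norm v)\<^sup>2) = ip v v" for v by (rule ip_self[symmetric])
  have "(of_real ((norm (x + y))\<^sup>2 + (norm (x - y))\<^sup>2) :: 'k)
        = of_real (2 * (norm x)\<^sup>2 + 2 * (norm y)\<^sup>2)"
    unfolding of_real_add of_real_mult sq
    by (simp add: ip_add_left ip_add_right ip_diff_left ip_diff_right algebra_simps)
  then show ?thesis by (simp only: of_real_eq_iff)
qed

lemma bounded_bilinear_ip: "bounded_bilinear ip"
proof
  fix r x y
  show "ip (r *\<^sub>R x) y = r *\<^sub>R ip x y" "ip x (r *\<^sub>R y) = r *\<^sub>R ip x y"
    by (simp_all add: scale_of_real[symmetric] ip_scale_left ip_scale_right scaleR_conv_of_real)
  show "\<exists>K. \<forall>a b. norm (ip a b) \<le> norm a * norm b * K"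
    using cauchy_schwarz by (intro exI[of _ 1]) simp
qed (simp_all add: ip_add_left ip_add_right)

lemma bounded_bilinear_smul: "bounded_bilinear smul"
proof
  fix r c x
  show "smul (r *\<^sub>R c) x = r *\<^sub>R smul c x" "smul c (r *\<^sub>R x) = r *\<^sub>R smul c x"
    by (simp_all add: scale_of_real[symmetric] scaleR_conv_of_real mult.commute)
  show "\<exists>K. \<forall>a b. norm (smul a b) \<le> norm a * norm b * K"
    by (intro exI[of _ 1]) (simp add: norm_smul)
qed (simp_all add: scale_left_distrib scale_right_distrib)

lemmas tendsto_ip = bounded_bilinear.tendsto[OF bounded_bilinear_ip]
lemmas tendsto_smul = bounded_bilinear.tendsto[OF bounded_bilinear_smul]
lemmas ip_sum_left = bounded_bilinear.sum_left[OF bounded_bilinear_ip]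
lemmas ip_sum_right = bounded_bilinear.sum_right[OF bounded_bilinear_ip]

lemma sums_ip_left: "u sums x \<Longrightarrow> (\<lambda>n. ip (u n) y) sums ip x y"
  by (rule bounded_linear.sums[OF bounded_bilinear.bounded_linear_left[OF bounded_bilinear_ip]])

lemma sums_ip_right: "u sums y \<Longrightarrow> (\<lambda>n. ip x (u n)) sums ip x y"
  by (rule bounded_linear.sums[OF bounded_bilinear.bounded_linear_right[OF bounded_bilinear_ip]])

lemma eq_if_ip_eq:
  assumes "\<And>x. ip x y = ip x z"
  shows "y = z"
proof -
  have "ip (y - z) (y - z) = 0" using assms by (simp add: ip_diff_right)
  then show ?thesis by (simp add: ip_self)
qed

text \<open>
  A minimizing sequence is Cauchy: midpoints stay in \<open>S\<close>, so their norm is at least the infimum, and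
  the parallelogram law then bounds the squared distance of two members by the excess of their squared norms.
\<close>

lemma min_norm_in_closure:
  fixes S :: "'a set"
  assumes "convex S" "S \<noteq> {}"
  obtains z where "z \<in> closure S" "\<And>s. s \<in> closure S \<Longrightarrow> norm z \<le> norm s"
proof -
  define d where "d = Inf (norm ` S)"
  have bdd: "bdd_below (norm ` S)" by (auto intro!: bdd_belowI[of _ 0])
  have d_le: "d \<le> norm s" if "s \<in> S" for s
    unfolding d_def using bdd that by (auto intro: cInf_lower)
  have d0: "0 \<le> d" unfolding d_def using assms(2) by (auto intro: cInf_greatest)
  have "\<exists>s\<in>S. norm s < d + inverse (real (Suc k))" for k
    using cInf_lessD[of "norm ` S" "d + inverse (real (Suc k))"] assms(2) by (auto simp: d_def)
  then obtain s where s: "\<And>k. s k \<in> S" "\<And>k. norm (s k) < d + inverse (real (Suc k))" by metis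
  have lim_s: "(\<lambda>k. norm (s k)) \<longlonglongrightarrow> d"
  proof (rule tendsto_sandwich)
    show "\<forall>\<^sub>F k in sequentially. d \<le> norm (s k)" using d_le s(1) by simp
    show "\<forall>\<^sub>F k in sequentially. norm (s k) \<le> d + inverse (real (Suc k))"
      using s(2) by (simp add: less_imp_le)
    show "(\<lambda>k. d + inverse (real (Suc k))) \<longlonglongrightarrow> d"
      using tendsto_add[OF tendsto_const LIMSEQ_inverse_real_of_nat, of d] by simp
  qed simp
  have dist_sq: "(norm (s j - s k))\<^sup>2 \<le> 2 * ((norm (s j))\<^sup>2 - d\<^sup>2) + 2 * ((norm (s k))\<^sup>2 - d\<^sup>2)" for j k
  proof -
    have "(1/2) *\<^sub>R (s j + s k) \<in> S"
      unfolding scaleR_add_right by (rule convexD[OF assms(1) s(1) s(1)]) simp_all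
    from d_le[OF this] have "2 * d \<le> norm (s j + s k)" by simp
    then have "(2 * d)\<^sup>2 \<le> (norm (s j + s k))\<^sup>2" using d0 by (intro power_mono) auto
    then show ?thesis using parallelogram[of "s j" "s k"] by (simp add: power_mult_distrib)
  qed
  have "Cauchy s"
  proof (rule CauchyI)
    fix e :: real assume e: "0 < e"
    have "(\<lambda>k. (norm (s k))\<^sup>2 - d\<^sup>2) \<longlonglongrightarrow> d\<^sup>2 - d\<^sup>2" using lim_s by (intro tendsto_intros)
    moreover have "d\<^sup>2 - d\<^sup>2 < e\<^sup>2 / 4" using e by simp
    ultimately have "\<forall>\<^sub>F k in sequentially. (norm (s k))\<^sup>2 - d\<^sup>2 < e\<^sup>2 / 4"
      by (rule order_tendstoD(2))
    then obtain M where M: "\<And>k. k \<ge> M \<Longrightarrow> (norm (s k))\<^sup>2 - d\<^sup>2 < e\<^sup>2 / 4"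
      by (auto simp: eventually_sequentially)
    have "norm (s j - s k) < e" if "j \<ge> M" "k \<ge> M" for j k
    proof -
      have "(norm (s j - s k))\<^sup>2 < e\<^sup>2" using dist_sq[of j k] M[OF that(1)] M[OF that(2)] by simp
      then show ?thesis using e by (simp add: power_less_imp_less_base)
    qed
    then show "\<exists>M. \<forall>j\<ge>M. \<forall>k\<ge>M. norm (s j - s k) < e" by blast
  qed
  then have "convergent s" by (rule Cauchy_convergent)
  then obtain z where z: "s \<longlonglongrightarrow> z" unfolding convergent_def by blast
  show thesis
  proof
    show "z \<in> closure S" using s(1) z by (rule limit_in_closure)
    fix t assume "t \<in> closure S"
    then obtain u where u: "\<And>k. u k \<in> S" "u \<longlonglongrightarrow> t" using closure_sequential by blast
    have "norm z = d" using LIMSEQ_unique[OF tendsto_norm[OF z] lim_s] .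
    also have "d \<le> norm t" using d_le u by (intro LIMSEQ_le_const[OF tendsto_norm[OF u(2)]]) auto
    finally show "norm z \<le> norm t" .
  qed
qed

section \<open>Representation of functionals and adjoints\<close>

text \<open>
  A functional \<open>\<phi>\<close> dominated by \<open>U\<close> is the pullback along \<open>U\<close> of a functional on the range of \<open>U\<close>.
  Representing it by a vector of the closure of that range covers the Riesz theorem (\<open>U\<close> the
  identity) and the factorization of operators. The usual proof adapts: the vector \<open>z\<close> of minimal norm in
  the closure of \<open>U ` {x. \<phi> x = 1}\<close> is orthogonal to \<open>U ` {x. \<phi> x = 0}\<close>, so that
  \<open>\<langle>U x, z\<rangle> = \<phi> x * \<parallel>z\<parallel>\<^sup>2\<close>, and \<open>z / \<parallel>z\<parallel>\<^sup>2\<close> represents \<open>\<phi>\<close>.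
\<close>

lemma riesz_through:
  fixes s :: "'k \<Rightarrow> 'b::ab_group_add \<Rightarrow> 'b" and U :: "'b \<Rightarrow> 'a" and \<phi> :: "'b \<Rightarrow> 'k"
  assumes "Vector_Spaces.linear s smul U" "Vector_Spaces.linear s (*) \<phi>"
    and bound: "\<And>x. norm (\<phi> x) \<le> K * norm (U x)" and "0 \<le> K"
  obtains b where "b \<in> closure (range U)" "\<And>x. \<phi> x = ip (U x) b" "norm b \<le> K"
proof -
  interpret U: Vector_Spaces.linear s smul U by fact
  interpret \<phi>: Vector_Spaces.linear s "(*)" \<phi> by fact
  show thesis
  proof (cases "\<forall>x. \<phi> x = 0")
    case True
    have "0 \<in> range U" by (metis U.zero rangeI)
    then have "0 \<in> closure (range U)" by (rule closure_subset[THEN subsetD])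
    then show thesis using True \<open>0 \<le> K\<close> by (intro that[of 0]) auto
  next
    case False
    then obtain x0 where x0: "\<phi> x0 \<noteq> 0" by blast
    define S where "S = U ` {x. \<phi> x = 1}"
    have "\<phi> (s (1 / \<phi> x0) x0) = 1" using x0 by (simp add: \<phi>.scale)
    then have "S \<noteq> {}" unfolding S_def by blast
    have "convex S"
    proof (rule convexI)
      fix p q :: 'a and u v :: real
      assume "p \<in> S" "q \<in> S" and uv: "u + v = 1"
      then obtain x y where xy: "p = U x" "\<phi> x = 1" "q = U y" "\<phi> y = 1" unfolding S_def by blast
      have "\<phi> (s (of_real u) x + s (of_real v) y) = of_real (u + v)"
        by (simp add: \<phi>.add \<phi>.scale xy)
      then have "\<phi> (s (of_real u) x + s (of_real v) y) = 1" by (simp add: uv)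
      moreover have "u *\<^sub>R p + v *\<^sub>R q = U (s (of_real u) x + s (of_real v) y)"
        by (simp add: U.add U.scale xy scale_of_real)
      ultimately show "u *\<^sub>R p + v *\<^sub>R q \<in> S" unfolding S_def by blast
    qed
    then obtain z where zS: "z \<in> closure S" and z_min: "\<And>t. t \<in> closure S \<Longrightarrow> norm z \<le> norm t"
      using min_norm_in_closure \<open>S \<noteq> {}\<close> by metis
    obtain w where wS: "\<And>k. w k \<in> S" and w: "w \<longlonglongrightarrow> z"
      using zS closure_sequential by blast
    \<comment> \<open>translations by \<open>U h\<close> with \<open>\<phi> h = 0\<close> preserve \<open>S\<close>, hence its closure, in which \<open>z\<close> has minimal norm\<close>
    have orth: "ip (U h) z = 0" if "\<phi> h = 0" for h
    proof -
      have "ip z (U h) = 0"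
      proof (rule orthogonal_if_norm_minimal)
        fix t
        have "w k - smul t (U h) \<in> S" for k
        proof -
          obtain x where x: "w k = U x" "\<phi> x = 1" using wS[of k] unfolding S_def by blast
          have "w k - smul t (U h) = U (x - s t h)" by (simp add: U.diff U.scale x)
          moreover have "\<phi> (x - s t h) = 1" by (simp add: \<phi>.diff \<phi>.scale that x)
          ultimately show ?thesis unfolding S_def by blast
        qed
        moreover have "(\<lambda>k. w k - smul t (U h)) \<longlonglongrightarrow> z - smul t (U h)"
          by (intro tendsto_intros w)
        ultimately have "z - smul t (U h) \<in> closure S" by (rule limit_in_closure)
        then show "norm z \<le> norm (z - smul t (U h))" by (rule z_min)
      qed
      then show ?thesis by (metis ip_commute cj_0)
    qed
    \<comment> \<open>for \<open>U y \<in> S\<close> the vector \<open>x - \<phi> x y\<close> is in the kernel of \<open>\<phi>\<close>; \<open>z\<close> itself need not lie in the range, hence the limit\<close>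
    have rep: "ip (U x) z = \<phi> x * ip z z" for x
    proof (rule LIMSEQ_unique)
      have "ip (U x) z = \<phi> x * ip (w k) z" for k
      proof -
        obtain y where y: "w k = U y" "\<phi> y = 1" using wS[of k] unfolding S_def by blast
        have "ip (U (x - s (\<phi> x) y)) z = 0" by (rule orth) (simp add: \<phi>.diff \<phi>.scale y)
        then show ?thesis by (simp add: U.diff U.scale ip_diff_left ip_scale_left y)
      qed
      then show "(\<lambda>k. \<phi> x * ip (w k) z) \<longlonglongrightarrow> ip (U x) z" by simp
      show "(\<lambda>k. \<phi> x * ip (w k) z) \<longlonglongrightarrow> \<phi> x * ip z z"
        by (intro tendsto_intros tendsto_ip w)
    qed
    have one_le: "1 \<le> K * norm z"
    proof (rule LIMSEQ_le_const)
      show "(\<lambda>k. K * norm (w k)) \<longlonglongrightarrow> K * norm z" by (intro tendsto_intros w)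
      have "1 \<le> K * norm (w k)" for k
        using wS[of k] bound unfolding S_def by (metis (mono_tags, lifting) imageE mem_Collect_eq norm_one)
      then show "\<exists>N. \<forall>n\<ge>N. 1 \<le> K * norm (w n)" by blast
    qed
    then have z0: "z \<noteq> 0" by auto
    define c :: 'k where "c = of_real (1 / (norm z)\<^sup>2)"
    show thesis
    proof (rule that[of "smul c z"])
      have "smul c (w k) \<in> range U" for k
        using wS[of k] unfolding S_def by (auto simp flip: U.scale)
      moreover have "(\<lambda>k. smul c (w k)) \<longlonglongrightarrow> smul c z" by (intro tendsto_smul tendsto_const w)
      ultimately show "smul c z \<in> closure (range U)" by (rule limit_in_closure)
      show "\<phi> x = ip (U x) (smul c z)" for x
        using z0 unfolding ip_scale_right rep ip_self c_def cj_of_real by simp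
      have "norm (smul c z) = 1 / norm z"
        using z0 by (simp add: norm_smul c_def power2_eq_square norm_divide norm_mult)
      also have "\<dots> \<le> K" using one_le z0 by (simp add: divide_le_eq)
      finally show "norm (smul c z) \<le> K" .
    qed
  qed
qed

lemma linear_ip_left: "Vector_Spaces.linear smul (*) (\<lambda>x. ip x y)"
  by unfold_locales (auto simp: algebra_simps ip_add_left ip_scale_left)

lemma riesz_representation:
  fixes \<phi> :: "'a \<Rightarrow> 'k"
  assumes "Vector_Spaces.linear smul (*) \<phi>" "\<And>x. norm (\<phi> x) \<le> K * norm x" "0 \<le> K"
  obtains b where "\<And>x. \<phi> x = ip x b" "norm b \<le> K"
proof -
  have "Vector_Spaces.linear smul smul (\<lambda>x. x)"
    by unfold_locales simp_all
  from riesz_through[OF this, of \<phi> K] assms that show thesis by metis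
qed

lemma bounded_operatorE:
  assumes "bounded_operator smul L"
  obtains K where "0 \<le> K" "\<And>x. norm (L x) \<le> K * norm x"
proof -
  obtain K where K: "\<And>x. norm (L x) \<le> K * norm x" using assms unfolding bounded_operator_def by blast
  have "norm (L x) \<le> \<bar>K\<bar> * norm x" for x
    by (rule order_trans[OF K mult_right_mono[OF abs_ge_self norm_ge_zero]])
  then show thesis using that[of "\<bar>K\<bar>"] by simp
qed

text \<open>
  Existence comes from the Riesz theorem, applied to \<open>x \<mapsto> \<langle>L x, y\<rangle>\<close> for each \<open>y\<close>; together with
  uniqueness it makes the description in the definition of the adjoint a proper one.
\<close>

lemma hilbert_adjoint:
  assumes "bounded_operator smul L"
  shows "ip (L x) y = ip x (hilbert_adjoint ip L y)"
proof -
  obtain K where K: "0 \<le> K" "\<And>x. norm (L x) \<le> K * norm x" using bounded_operatorE[OF assms] by blast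
  interpret L: Vector_Spaces.linear smul smul L using assms by (simp add: bounded_operator_def)
  have "\<exists>b. \<forall>x. ip (L x) y = ip x b" for y
  proof -
    have "Vector_Spaces.linear smul (*) (\<lambda>x. ip (L x) y)"
      by unfold_locales (auto simp: algebra_simps L.add L.scale ip_add_left ip_scale_left)
    moreover have "norm (ip (L x) y) \<le> (K * norm y) * norm x" for x
      using order_trans[OF cauchy_schwarz mult_right_mono[OF K(2)[of x] norm_ge_zero[of y]]]
      by (simp add: mult_ac)
    ultimately show ?thesis
      using riesz_representation[of "\<lambda>x. ip (L x) y" "K * norm y"] K(1) by (metis mult_nonneg_nonneg norm_ge_zero)
  qed
  then obtain M where M: "\<forall>x y. ip (L x) y = ip x (M y)" by metis
  have "\<exists>!M. \<forall>x y. ip (L x) y = ip x (M y)"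
  proof (rule ex1I[of _ M])
    fix N assume N: "\<forall>x y. ip (L x) y = ip x (N y)"
    show "N = M"
    proof
      fix y show "N y = M y" by (rule eq_if_ip_eq) (metis M N)
    qed
  qed (rule M)
  from theI'[OF this] show ?thesis unfolding hilbert_adjoint_def by blast
qed

end

section \<open>The Hilbert space of square summable sequences\<close>

lemma l2_norm_nonneg: "0 \<le> l2_norm c" if "c \<in> l2"
  using that by (simp add: l2_def l2_norm_def suminf_nonneg)

lemma L2_set_le_l2_norm:
  assumes "c \<in> l2" "finite F"
  shows "L2_set (\<lambda>n. norm (c n)) F \<le> l2_norm c"
  using assms unfolding L2_set_def l2_norm_def l2_def
  by (auto intro!: real_sqrt_le_mono sum_le_suminf)

text \<open>
  Square summability and norm bounds are reduced to finite sections, for which the triangle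
  inequality is available; limits can also be taken section by section.
\<close>

lemma l2_if_L2_set_bounded:
  assumes "\<And>N. L2_set (\<lambda>n. norm (c n)) {..<N} \<le> K"
  shows "c \<in> l2" "l2_norm c \<le> K"
proof -
  have K0: "0 \<le> K" using assms[of 0] by simp
  have le: "(\<Sum>n<N. (norm (c n))\<^sup>2) \<le> K\<^sup>2" for N
    using assms[of N] K0 unfolding L2_set_def
    by (metis real_sqrt_le_iff real_sqrt_abs abs_of_nonneg)
  then have *: "summable (\<lambda>n. (norm (c n))\<^sup>2)" by (intro summableI_nonneg_bounded) auto
  then show "c \<in> l2" by (simp add: l2_def)
  have "(\<Sum>n. (norm (c n))\<^sup>2) \<le> K\<^sup>2" using * le by (rule suminf_le_const)
  then show "l2_norm c \<le> K" unfolding l2_norm_def using K0 by (rule real_le_lsqrt[rotated])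
qed

lemma l2_norm_square: "(l2_norm c)\<^sup>2 = (\<Sum>n. (norm (c n))\<^sup>2)" if "c \<in> l2"
  using that by (simp add: l2_def l2_norm_def suminf_nonneg)

lemma
  assumes "a \<in> l2" "b \<in> l2"
  shows l2_add: "(\<lambda>n. a n + b n) \<in> l2"
    and l2_norm_triangle_ineq: "l2_norm (\<lambda>n. a n + b n) \<le> l2_norm a + l2_norm b"
proof -
  have "L2_set (\<lambda>n. norm (a n + b n)) {..<N} \<le> l2_norm a + l2_norm b" for N
  proof -
    have "L2_set (\<lambda>n. norm (a n + b n)) {..<N} \<le> L2_set (\<lambda>n. norm (a n) + norm (b n)) {..<N}"
      by (intro L2_set_mono norm_triangle_ineq) simp
    also have "\<dots> \<le> l2_norm a + l2_norm b"
      by (rule order_trans[OF L2_set_triangle_ineq])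
        (intro add_mono L2_set_le_l2_norm assms; simp)
    finally show ?thesis .
  qed
  from l2_if_L2_set_bounded[OF this]
  show "(\<lambda>n. a n + b n) \<in> l2" "l2_norm (\<lambda>n. a n + b n) \<le> l2_norm a + l2_norm b" .
qed

text \<open>
  The space \<open>\<ell>\<^sup>2\<close> becomes a type of its own, so that it is a Banach space in the sense of the type
  classes and the results on Hilbert spaces and uniform boundedness apply to it.
\<close>

typedef (overloaded) 'k ell2 = "l2 :: (nat \<Rightarrow> 'k::conj_field) set"
  morphisms coeff Abs_ell2
  by (intro exI[of _ "\<lambda>_. 0"]) (simp add: l2_def)

setup_lifting type_definition_ell2

lemma ell2_eqI: "(\<And>n. coeff a n = coeff b n) \<Longrightarrow> a = b"
  by (simp add: coeff_inject[symmetric] fun_eq_iff)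

instantiation ell2 :: (conj_field) real_vector
begin

lift_definition zero_ell2 :: "'a ell2" is "\<lambda>_. 0" by (simp add: l2_def)

lift_definition plus_ell2 :: "'a ell2 \<Rightarrow> 'a ell2 \<Rightarrow> 'a ell2" is "\<lambda>a b n. a n + b n"
  by (rule l2_add)

lift_definition uminus_ell2 :: "'a ell2 \<Rightarrow> 'a ell2" is "\<lambda>a n. - a n" by (simp add: l2_def)

definition minus_ell2 :: "'a ell2 \<Rightarrow> 'a ell2 \<Rightarrow> 'a ell2" where "a - b = a + - b" for a b :: "'a ell2"

lift_definition scaleR_ell2 :: "real \<Rightarrow> 'a ell2 \<Rightarrow> 'a ell2" is "\<lambda>r a n. r *\<^sub>R a n"
  by (simp add: l2_def power_mult_distrib summable_mult)

lemma coeff_zero [simp]: "coeff 0 n = 0" by transfer simp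
lemma coeff_add [simp]: "coeff (a + b) n = coeff a n + coeff b n" by transfer simp
lemma coeff_uminus [simp]: "coeff (- a) n = - coeff a n" by transfer simp
lemma coeff_diff [simp]: "coeff (a - b) n = coeff a n - coeff b n" by (simp add: minus_ell2_def)
lemma coeff_scaleR [simp]: "coeff (r *\<^sub>R a) n = r *\<^sub>R coeff a n" by transfer simp

instance
  by standard (rule ell2_eqI; simp add: algebra_simps)+

end

lemma coeff_in_l2: "coeff a \<in> l2" by (rule coeff)

instantiation ell2 :: (conj_field) real_normed_vector
begin

definition norm_ell2 :: "'a ell2 \<Rightarrow> real" where "norm a = l2_norm (coeff a)" for a :: "'a ell2"
definition dist_ell2 :: "'a ell2 \<Rightarrow> 'a ell2 \<Rightarrow> real" where "dist a b = norm (a - b)" for a b :: "'a ell2"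
definition sgn_ell2 :: "'a ell2 \<Rightarrow> 'a ell2" where "sgn a = a /\<^sub>R norm a" for a :: "'a ell2"
definition uniformity_ell2 :: "('a ell2 \<times> 'a ell2) filter" where
  "uniformity_ell2 = (INF e\<in>{0 <..}. principal {(a, b). dist a b < e})"
definition open_ell2 :: "'a ell2 set \<Rightarrow> bool" where
  "open_ell2 U = (\<forall>a\<in>U. \<forall>\<^sub>F (a', b) in uniformity. a' = a \<longrightarrow> b \<in> U)" for U :: "'a ell2 set"

instance
proof
  fix a b :: "'a ell2" and r :: real
  show "norm a = 0 \<longleftrightarrow> a = 0"
    using coeff_in_l2[of a]
    by (auto simp: norm_ell2_def l2_norm_def l2_def suminf_eq_zero_iff intro: ell2_eqI)
  show "norm (a + b) \<le> norm a + norm b"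
    unfolding norm_ell2_def
    using l2_norm_triangle_ineq[OF coeff_in_l2[of a] coeff_in_l2[of b]] by (simp flip: coeff_add)
  show "norm (r *\<^sub>R a) = \<bar>r\<bar> * norm a"
    using coeff_in_l2[of a]
    by (simp add: norm_ell2_def l2_norm_def l2_def power_mult_distrib suminf_mult real_sqrt_mult)
qed (auto simp: dist_ell2_def sgn_ell2_def uniformity_ell2_def open_ell2_def)

end

lemma norm_coeff_le: "norm (coeff a n) \<le> norm a"
  using L2_set_le_l2_norm[OF coeff_in_l2[of a], of "{n}"] by (simp add: norm_ell2_def)

lemma bounded_linear_coeff: "bounded_linear (\<lambda>a. coeff a n)"
  by (rule bounded_linear_intro[where K=1]) (simp_all add: norm_coeff_le)

text \<open>
  The coordinatewise limit \<open>b\<close> of a Cauchy sequence is approached in norm, since the bound on finite sections of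
  \<open>X m - X k\<close> survives the limit in \<open>k\<close>. A priori \<open>b\<close> is only a sequence of scalars; it is square summable because
  \<open>X M - b\<close> is.
\<close>

instance ell2 :: (conj_field) banach
proof
  fix X :: "nat \<Rightarrow> 'a ell2" assume "Cauchy X"
  have "convergent (\<lambda>k. coeff (X k) n)" for n
    using bounded_linear.Cauchy[OF bounded_linear_coeff \<open>Cauchy X\<close>] by (rule Cauchy_convergent)
  then obtain b where b: "\<And>n. (\<lambda>k. coeff (X k) n) \<longlonglongrightarrow> b n"
    unfolding convergent_def by metis
  have tail: "\<exists>M. \<forall>m\<ge>M. \<forall>N. L2_set (\<lambda>n. norm (coeff (X m) n - b n)) {..<N} \<le> e" if "0 < e" for e
  proof -
    obtain M where M: "\<And>m k. m \<ge> M \<Longrightarrow> k \<ge> M \<Longrightarrow> norm (X m - X k) < e"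
      using \<open>Cauchy X\<close> \<open>0 < e\<close> unfolding Cauchy_iff by blast
    have "L2_set (\<lambda>n. norm (coeff (X m) n - b n)) {..<N} \<le> e" if "m \<ge> M" for m N
    proof (rule LIMSEQ_le_const2)
      show "(\<lambda>k. L2_set (\<lambda>n. norm (coeff (X m) n - coeff (X k) n)) {..<N})
             \<longlonglongrightarrow> L2_set (\<lambda>n. norm (coeff (X m) n - b n)) {..<N}"
        unfolding L2_set_def by (intro tendsto_intros b)
      have "L2_set (\<lambda>n. norm (coeff (X m) n - coeff (X k) n)) {..<N} \<le> e" if "k \<ge> M" for k
        using L2_set_le_l2_norm[OF coeff_in_l2[of "X m - X k"], of "{..<N}"] M[OF \<open>m \<ge> M\<close> that]
        by (simp add: norm_ell2_def)
      then show "\<exists>K. \<forall>k\<ge>K. L2_set (\<lambda>n. norm (coeff (X m) n - coeff (X k) n)) {..<N} \<le> e" by blast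
    qed
    then show ?thesis by blast
  qed
  obtain M where "\<And>N. L2_set (\<lambda>n. norm (coeff (X M) n - b n)) {..<N} \<le> 1" using tail[of 1] by auto
  then have "(\<lambda>n. coeff (X M) n - b n) \<in> l2" by (rule l2_if_L2_set_bounded(1))
  then obtain d where d: "coeff d = (\<lambda>n. coeff (X M) n - b n)" using Abs_ell2_inverse by blast
  define B where "B = X M - d"
  have B: "coeff B n = b n" for n by (simp add: B_def d)
  have "X \<longlonglongrightarrow> B"
  proof (rule LIMSEQ_I)
    fix r :: real assume "0 < r"
    then obtain M where M: "\<And>m N. m \<ge> M \<Longrightarrow> L2_set (\<lambda>n. norm (coeff (X m) n - b n)) {..<N} \<le> r / 2"
      using tail[of "r / 2"] by auto
    have "norm (X m - B) < r" if "m \<ge> M" for m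
    proof -
      have "norm (X m - B) \<le> r / 2"
        unfolding norm_ell2_def using M[OF that] by (intro l2_if_L2_set_bounded(2)) (simp add: B)
      then show ?thesis using \<open>0 < r\<close> by simp
    qed
    then show "\<exists>M. \<forall>m\<ge>M. norm (X m - B) < r" by blast
  qed
  then show "convergent X" by (rule convergentI)
qed

lift_definition smul_ell2 :: "'k::conj_field \<Rightarrow> 'k ell2 \<Rightarrow> 'k ell2" is "\<lambda>c a n. c * a n"
  by (simp add: l2_def norm_mult power_mult_distrib summable_mult)

definition ip_ell2 :: "'k::conj_field ell2 \<Rightarrow> 'k ell2 \<Rightarrow> 'k" where
  "ip_ell2 a b = (\<Sum>n. coeff a n * cj (coeff b n))"

lemma coeff_smul [simp]: "coeff (smul_ell2 c a) n = c * coeff a n" by transfer simp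

lemma ip_ell2_sums: "(\<lambda>n. coeff a n * cj (coeff b n)) sums ip_ell2 a b"
proof -
  have "summable (\<lambda>n. norm (coeff a n * cj (coeff b n)))"
  proof (rule summable_comparison_test'[where N = 0])
    show "summable (\<lambda>n. (norm (coeff a n))\<^sup>2 + (norm (coeff b n))\<^sup>2)"
      using coeff_in_l2[of a] coeff_in_l2[of b] by (intro summable_add) (simp_all add: l2_def)
    fix n
    show "norm (norm (coeff a n * cj (coeff b n))) \<le> (norm (coeff a n))\<^sup>2 + (norm (coeff b n))\<^sup>2"
      using sum_squares_bound[of "norm (coeff a n)" "norm (coeff b n)"]
        mult_nonneg_nonneg[of "norm (coeff a n)" "norm (coeff b n)"]
      by (simp add: norm_mult del: mult_nonneg_nonneg)
  qed
  then show ?thesis unfolding ip_ell2_def by (rule summable_sums[OF summable_norm_cancel])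
qed

lemma hilbert_space_ell2: "hilbert_space smul_ell2 ip_ell2"
proof unfold_locales
  fix x y z :: "'k::conj_field ell2" and c d :: 'k and r
  show "smul_ell2 c (x + y) = smul_ell2 c x + smul_ell2 c y"
    "smul_ell2 (c + d) x = smul_ell2 c x + smul_ell2 d x"
    "smul_ell2 c (smul_ell2 d x) = smul_ell2 (c * d) x" "smul_ell2 1 x = x"
    "smul_ell2 (of_real r) x = r *\<^sub>R x"
    by (auto intro!: ell2_eqI simp: algebra_simps scaleR_conv_of_real)
  have "(\<lambda>n. coeff x n * cj (coeff z n) + coeff y n * cj (coeff z n)) sums (ip_ell2 x z + ip_ell2 y z)"
    by (intro sums_add ip_ell2_sums)
  then show "ip_ell2 (x + y) z = ip_ell2 x z + ip_ell2 y z"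
    by (intro sums_unique2[OF ip_ell2_sums]) (simp add: distrib_right)
  have "(\<lambda>n. c * (coeff x n * cj (coeff y n))) sums (c * ip_ell2 x y)"
    by (intro sums_mult ip_ell2_sums)
  then show "ip_ell2 (smul_ell2 c x) y = c * ip_ell2 x y"
    by (intro sums_unique2[OF ip_ell2_sums]) (simp add: mult.assoc)
  have "(\<lambda>n. cj (coeff y n * cj (coeff x n))) sums cj (ip_ell2 y x)"
    by (intro bounded_linear.sums[OF bounded_linear_cj] ip_ell2_sums)
  then show "ip_ell2 x y = cj (ip_ell2 y x)"
    by (intro sums_unique2[OF ip_ell2_sums]) (simp add: cj_mult mult.commute)
  have "(\<lambda>n. of_real ((norm (coeff x n))\<^sup>2)) sums (of_real ((norm x)\<^sup>2) :: 'k)"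
    using coeff_in_l2[of x]
    by (intro sums_of_real) (simp add: norm_ell2_def l2_norm_square l2_def summable_sums)
  then show "ip_ell2 x x = of_real ((norm x)\<^sup>2)"
    using ip_ell2_sums[of x x] unfolding mult_cj_of_real by (intro sums_unique2)
qed

interpretation ell2: hilbert_space smul_ell2 ip_ell2
  by (rule hilbert_space_ell2)

section \<open>Uniform boundedness\<close>

text \<open>
  The Banach-Steinhaus theorem for seminorms. By the Baire category theorem one of the closed
  sets on which all \<open>p n\<close> are at most \<open>k\<close> contains a ball. Its centre \<open>x0\<close> is removed by
  subadditivity, so all \<open>p n\<close> are at most \<open>2 * k\<close> on a ball around the origin.
\<close>

lemma uniform_boundedness:
  fixes p :: "nat \<Rightarrow> 'b::banach \<Rightarrow> real"
  assumes cont: "\<And>n. continuous_on UNIV (p n)"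
    and add: "\<And>n x y. p n (x + y) \<le> p n x + p n y"
    and scale: "\<And>n r x. p n (r *\<^sub>R x) = \<bar>r\<bar> * p n x"
    and bounded: "\<And>x. \<exists>K. \<forall>n. p n x \<le> K"
  obtains K where "0 \<le> K" "\<And>n x. p n x \<le> K * norm x"
proof -
  define E where "E k = {x. \<forall>n. p n x \<le> real k}" for k :: nat
  have closed_E: "closed (E k)" for k
    unfolding E_def by (intro closed_Collect_all closed_Collect_le cont continuous_on_const)
  have "x \<in> (\<Union>k. E k)" for x
  proof -
    obtain K where "\<forall>n. p n x \<le> K" using bounded by blast
    then have "x \<in> E (nat \<lceil>K\<rceil>)" unfolding E_def by (auto intro: order_trans[OF _ real_nat_ceiling_ge])
    then show ?thesis by blast
  qed
  then have "(\<Union>k. E k) = UNIV" by blast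
  then have "euclidean interior_of \<Union>(range E) \<noteq> {}" by simp
  moreover have "euclidean interior_of \<Union>(range E) = {}" if "\<And>k. interior (E k) = {}"
    using closed_E that
    by (intro Baire_category_alt disjI1 completely_metrizable_space_euclidean) auto
  ultimately obtain k x0 where "x0 \<in> interior (E k)" by blast
  then obtain r where r: "0 < r" "ball x0 r \<subseteq> E k" unfolding mem_interior by blast
  have p0: "p n 0 = 0" for n using scale[of n 0 0] by simp
  have "p n x \<le> (4 * real k / r) * norm x" for n x
  proof (cases "x = 0")
    case False
    \<comment> \<open>the factor 2 keeps \<open>x0 + t *\<^sub>R x\<close> inside the open ball\<close>
    define t where "t = r / (2 * norm x)"
    have t: "0 < t" using r False by (simp add: t_def)
    have "x0 + t *\<^sub>R x \<in> ball x0 r" "x0 \<in> ball x0 r"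
      using r False by (auto simp: dist_norm t_def)
    then have le: "p n (x0 + t *\<^sub>R x) \<le> k" "p n x0 \<le> k" using r(2) unfolding E_def by blast+
    have "t * p n x = p n ((x0 + t *\<^sub>R x) + (-1) *\<^sub>R x0)" using t by (simp add: scale)
    also have "\<dots> \<le> 2 * real k"
      using add[of n "x0 + t *\<^sub>R x" "(-1) *\<^sub>R x0"] le unfolding scale by simp
    finally have "p n x \<le> 2 * real k / t" using t by (simp add: field_simps)
    then show ?thesis using False by (simp add: t_def)
  qed (simp add: p0)
  then show thesis using r that[of "4 * real k / r"] by simp
qed

section \<open>Bessel sequences and their synthesis operators\<close>

context hilbert_space
begin

text \<open>
  The Bessel condition is the boundedness of the analysis operator \<open>x \<mapsto> (\<langle>x, f\<^sub>n\<rangle>)\<^sub>n\<close> into \<open>\<ell>\<^sup>2\<close>. A bound \<open>K\<close>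
  may vanish whereas \<open>B\<close> may not, whence \<open>B = K\<^sup>2 + 1\<close>.
\<close>

lemma bessel_sequence_iff:
  "bessel_sequence ip f \<longleftrightarrow>
     (\<exists>K\<ge>0. \<forall>x. (\<lambda>n. ip x (f n)) \<in> l2 \<and> l2_norm (\<lambda>n. ip x (f n)) \<le> K * norm x)"
proof
  assume "bessel_sequence ip f"
  then obtain B where B: "0 < B"
    "\<And>x. summable (\<lambda>n. (norm (ip x (f n)))\<^sup>2)"
    "\<And>x. (\<Sum>n. (norm (ip x (f n)))\<^sup>2) \<le> B * (norm x)\<^sup>2"
    unfolding bessel_sequence_def by blast
  have "l2_norm (\<lambda>n. ip x (f n)) \<le> sqrt B * norm x" for x
    using real_sqrt_le_mono[OF B(3)[of x]] by (simp add: l2_norm_def real_sqrt_mult)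
  then show "\<exists>K\<ge>0. \<forall>x. (\<lambda>n. ip x (f n)) \<in> l2 \<and> l2_norm (\<lambda>n. ip x (f n)) \<le> K * norm x"
    using B(1,2) by (intro exI[of _ "sqrt B"]) (simp add: l2_def)
next
  assume "\<exists>K\<ge>0. \<forall>x. (\<lambda>n. ip x (f n)) \<in> l2 \<and> l2_norm (\<lambda>n. ip x (f n)) \<le> K * norm x"
  then obtain K where K: "0 \<le> K" "\<And>x. (\<lambda>n. ip x (f n)) \<in> l2"
    "\<And>x. l2_norm (\<lambda>n. ip x (f n)) \<le> K * norm x" by blast
  have "(\<Sum>n. (norm (ip x (f n)))\<^sup>2) \<le> (K\<^sup>2 + 1) * (norm x)\<^sup>2" for x
  proof -
    have "(\<Sum>n. (norm (ip x (f n)))\<^sup>2) \<le> (K * norm x)\<^sup>2"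
      unfolding l2_norm_square[OF K(2), symmetric] by (intro power_mono K l2_norm_nonneg)
    also have "\<dots> \<le> (K\<^sup>2 + 1) * (norm x)\<^sup>2" by (simp add: power_mult_distrib distrib_right)
    finally show ?thesis .
  qed
  moreover have "0 < K\<^sup>2 + 1" by (simp add: add_nonneg_pos)
  ultimately show "bessel_sequence ip f"
    using K(2) unfolding bessel_sequence_def l2_def by blast
qed

text \<open>
  The norms of the finite sections of the analysis operator are seminorms, bounded at each point by
  the norm of the whole sequence.
\<close>

lemma bessel_sequence_if_pointwise:
  assumes "\<And>x. (\<lambda>n. ip x (f n)) \<in> l2"
  shows "bessel_sequence ip f"
proof -
  define p where "p N x = L2_set (\<lambda>n. norm (ip x (f n))) {..<N}" for N x
  obtain K where K: "0 \<le> K" "\<And>N x. p N x \<le> K * norm x"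
  proof (rule uniform_boundedness[of p])
    fix N x y and r :: real
    show "continuous_on UNIV (p N)" unfolding p_def L2_set_def
      by (intro continuous_intros bounded_linear.continuous_on[OF
            bounded_bilinear.bounded_linear_left[OF bounded_bilinear_ip]])
    have "p N (x + y) \<le> L2_set (\<lambda>n. norm (ip x (f n)) + norm (ip y (f n))) {..<N}"
      unfolding p_def by (intro L2_set_mono) (simp_all add: ip_add_left norm_triangle_ineq)
    also have "\<dots> \<le> p N x + p N y" unfolding p_def by (rule L2_set_triangle_ineq)
    finally show "p N (x + y) \<le> p N x + p N y" .
    show "p N (r *\<^sub>R x) = \<bar>r\<bar> * p N x"
      by (simp add: p_def L2_set_right_distrib norm_mult ip_scale_left flip: scale_of_real)
    show "\<exists>K. \<forall>N. p N x \<le> K" unfolding p_def using L2_set_le_l2_norm[OF assms] by blast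
  qed blast
  then show ?thesis
    unfolding bessel_sequence_iff p_def using assms l2_if_L2_set_bounded(2) by metis
qed

text \<open>
  The synthesis operator inherits its bound from the analysis operator, its adjoint: for
  \<open>y = \<Sum>\<^sub>n c\<^sub>n f\<^sub>n\<close> one has \<open>\<parallel>y\<parallel>\<^sup>2 = \<Sum>\<^sub>n c\<^sub>n \<langle>f\<^sub>n, y\<rangle> \<le> \<parallel>c\<parallel> K \<parallel>y\<parallel>\<close>. As \<open>F\<close> is an arbitrary finite set, the
  estimate applies to blocks of the series too.
\<close>

lemma synthesis_norm_le:
  assumes "\<And>x. (\<lambda>n. ip x (f n)) \<in> l2" "\<And>x. l2_norm (\<lambda>n. ip x (f n)) \<le> K * norm x" "finite F" "0 \<le> K"
  shows "norm (\<Sum>n\<in>F. smul (c n) (f n)) \<le> K * L2_set (\<lambda>n. norm (c n)) F"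
proof (cases "(\<Sum>n\<in>F. smul (c n) (f n)) = 0")
  case True
  then show ?thesis using assms(4) by simp
next
  case False
  define y where "y = (\<Sum>n\<in>F. smul (c n) (f n))"
  have "norm y * norm y = norm (ip y y)" by (simp add: ip_self power2_eq_square norm_mult)
  also have "ip y y = (\<Sum>n\<in>F. c n * ip (f n) y)"
    by (subst (1) y_def) (simp add: ip_sum_left ip_scale_left)
  also have "norm \<dots> \<le> (\<Sum>n\<in>F. \<bar>norm (c n)\<bar> * \<bar>norm (ip y (f n))\<bar>)"
    by (rule sum_norm_le) (metis abs_norm_cancel ip_commute norm_cj norm_mult order_refl)
  also have "\<dots> \<le> L2_set (\<lambda>n. norm (c n)) F * L2_set (\<lambda>n. norm (ip y (f n))) F"
    by (rule L2_set_mult_ineq)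
  also have "\<dots> \<le> L2_set (\<lambda>n. norm (c n)) F * (K * norm y)"
    using order_trans[OF L2_set_le_l2_norm[OF assms(1,3)] assms(2)]
    by (rule mult_left_mono) simp
  finally have "norm y \<le> K * L2_set (\<lambda>n. norm (c n)) F" using False by (simp add: y_def mult_ac)
  then show ?thesis by (simp add: y_def)
qed

lemma synthesis_summable:
  assumes "bessel_sequence ip f" "c \<in> l2"
  shows "summable (\<lambda>n. smul (c n) (f n))"
proof -
  obtain K where K: "0 \<le> K" "\<And>x. (\<lambda>n. ip x (f n)) \<in> l2"
    "\<And>x. l2_norm (\<lambda>n. ip x (f n)) \<le> K * norm x"
    using assms(1) unfolding bessel_sequence_iff by blast
  show ?thesis unfolding summable_Cauchy
  proof (intro allI impI)
    fix e :: real assume e: "0 < e"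
    \<comment> \<open>\<open>K + 1\<close> because \<open>K\<close> may be 0\<close>
    then have "0 < (e / (K + 1))\<^sup>2" using K by (intro zero_less_power divide_pos_pos) auto
    then obtain N where N: "\<And>m n. m \<ge> N \<Longrightarrow> norm (\<Sum>i\<in>{m..<n}. (norm (c i))\<^sup>2) < (e / (K + 1))\<^sup>2"
      using assms(2) unfolding l2_def summable_Cauchy by blast
    have "norm (\<Sum>i\<in>{m..<n}. smul (c i) (f i)) < e" if "m \<ge> N" for m n
    proof -
      have "L2_set (\<lambda>i. norm (c i)) {m..<n} < sqrt ((e / (K + 1))\<^sup>2)"
        unfolding L2_set_def using N[OF that, of n] by (intro real_sqrt_less_mono) simp
      then have L: "L2_set (\<lambda>i. norm (c i)) {m..<n} < e / (K + 1)" using e K by simp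
      have "norm (\<Sum>i\<in>{m..<n}. smul (c i) (f i)) \<le> K * L2_set (\<lambda>i. norm (c i)) {m..<n}"
        using K by (intro synthesis_norm_le) auto
      also have "\<dots> \<le> (K + 1) * L2_set (\<lambda>i. norm (c i)) {m..<n}"
        by (intro mult_right_mono) simp_all
      also have "\<dots> < e" using L K(1) by (simp add: field_simps)
      finally show ?thesis .
    qed
    then show "\<exists>N. \<forall>m\<ge>N. \<forall>n. norm (\<Sum>i\<in>{m..<n}. smul (c i) (f i)) < e" by blast
  qed
qed

text \<open>
  The partial sums of the synthesis operator converge pointwise on \<open>\<ell>\<^sup>2\<close>, so they are uniformly bounded;
  testing them on the first \<open>N\<close> analysis coefficients of \<open>x\<close> bounds these coefficients.
\<close>

lemma bessel_sequence_if_synthesis_summable: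
  assumes "\<And>c. c \<in> l2 \<Longrightarrow> summable (\<lambda>n. smul (c n) (f n))"
  shows "bessel_sequence ip f"
proof -
  define T where "T N a = (\<Sum>n<N. smul (coeff a n) (f n))" for N and a :: "'k ell2"
  have T_bounded: "bounded_linear (T N)" for N
    unfolding T_def
    by (intro bounded_linear_sum bounded_linear_compose[OF
          bounded_bilinear.bounded_linear_left[OF bounded_bilinear_smul] bounded_linear_coeff])
  obtain K where K: "0 \<le> K" "\<And>N a. norm (T N a) \<le> K * norm a"
  proof (rule uniform_boundedness[of "\<lambda>N a. norm (T N a)"])
    fix N and a b :: "'k ell2" and r :: real
    show "continuous_on UNIV (\<lambda>a. norm (T N a))"
      by (intro continuous_intros bounded_linear.continuous_on[OF T_bounded])
    show "norm (T N (a + b)) \<le> norm (T N a) + norm (T N b)"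
      unfolding linear_add[OF bounded_linear.linear[OF T_bounded]] by (rule norm_triangle_ineq)
    show "norm (T N (r *\<^sub>R a)) = \<bar>r\<bar> * norm (T N a)"
      unfolding linear_scale[OF bounded_linear.linear[OF T_bounded]] by simp
    have "convergent (\<lambda>N. T N a)"
      unfolding T_def using assms[OF coeff_in_l2] by (simp add: summable_iff_convergent)
    then have "Bseq (\<lambda>N. T N a)" by (rule convergent_imp_Bseq)
    then show "\<exists>K. \<forall>N. norm (T N a) \<le> K" unfolding Bseq_def by blast
  qed blast
  have "L2_set (\<lambda>n. norm (ip x (f n))) {..<N} \<le> K * norm x" for x N
  proof -
    define S where "S = L2_set (\<lambda>n. norm (ip x (f n))) {..<N}"
    define c where "c n = (if n < N then ip x (f n) else 0)" for n
    have "summable (\<lambda>n. (norm (c n))\<^sup>2)"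
      by (rule summable_finite[of "{..<N}"]) (simp_all add: c_def)
    then have "c \<in> l2" by (simp add: l2_def)
    then obtain a where a: "coeff a = c" using Abs_ell2_inverse by blast
    have norm_a: "norm a = S"
      unfolding norm_ell2_def a l2_norm_def S_def L2_set_def
      by (subst suminf_finite[of "{..<N}"]) (auto simp: c_def)
    have "of_real (S\<^sup>2) = (\<Sum>n<N. of_real ((norm (ip x (f n)))\<^sup>2) :: 'k)"
      by (simp add: S_def L2_set_def sum_nonneg)
    also have "\<dots> = ip x (T N a)"
      unfolding T_def ip_sum_right a
      by (intro sum.cong) (simp_all add: c_def ip_scale_right mult_cj_of_real[symmetric] mult.commute del: of_real_power)
    finally have "norm (ip x (T N a)) = S\<^sup>2" by (metis abs_power2 norm_of_real)
    then have "S * S \<le> norm x * norm (T N a)" using cauchy_schwarz[of x "T N a"] by (simp add: power2_eq_square)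
    also have "\<dots> \<le> norm x * (K * S)" using K(2)[of N a] by (intro mult_left_mono) (simp_all add: norm_a)
    finally have *: "S * S \<le> (K * norm x) * S" by (simp add: mult_ac)
    show ?thesis
    proof (cases "S = 0")
      case False
      moreover have "0 \<le> S" by (simp add: S_def)
      ultimately have "0 < S" by simp
      then have "S \<le> K * norm x" using * by (rule mult_right_le_imp_le[rotated])
      then show ?thesis by (simp add: S_def)
    qed (use K in \<open>simp add: S_def\<close>)
  qed
  from l2_if_L2_set_bounded[OF this] K(1) show ?thesis unfolding bessel_sequence_iff by blast
qed

text \<open>
  The new series converges because \<open>g\<close> is Bessel, and its limit is identified weakly: paired with \<open>x\<close>
  its terms are \<open>\<langle>x, g\<^sub>n\<rangle> \<langle>f\<^sub>n, y\<rangle>\<close>, which are the terms of \<open>\<langle>L x, y\<rangle> = \<langle>x, M y\<rangle>\<close>.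
\<close>

lemma adjoint_expansion:
  assumes L: "\<And>x. (\<lambda>n. smul (ip x (g n)) (f n)) sums L x"
    and adj: "\<And>x y. ip (L x) y = ip x (M y)"
    and "bessel_sequence ip f" "bessel_sequence ip g"
  shows "(\<lambda>n. smul (ip y (f n)) (g n)) sums M y"
proof -
  have "(\<lambda>n. ip y (f n)) \<in> l2" using assms(3) unfolding bessel_sequence_iff by blast
  then obtain z where z: "(\<lambda>n. smul (ip y (f n)) (g n)) sums z"
    using synthesis_summable[OF assms(4)] summable_sums by blast
  have "ip x z = ip x (M y)" for x
  proof (rule sums_unique2)
    show "(\<lambda>n. ip x (smul (ip y (f n)) (g n))) sums ip x z" by (rule sums_ip_right[OF z])
    have "(\<lambda>n. ip (smul (ip x (g n)) (f n)) y) sums ip (L x) y" by (rule sums_ip_left[OF L])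
    then show "(\<lambda>n. ip x (smul (ip y (f n)) (g n))) sums ip x (M y)"
      by (simp add: ip_scale_left ip_scale_right ip_commute[symmetric] adj mult.commute)
  qed
  then show ?thesis using z eq_if_ip_eq by metis
qed

section \<open>Douglas factorization\<close>

lemma closure_range_linear:
  fixes s :: "'k \<Rightarrow> 'b::ab_group_add \<Rightarrow> 'b"
  assumes "Vector_Spaces.linear s smul U" "b \<in> closure (range U)"
  shows "b' \<in> closure (range U) \<Longrightarrow> b + b' \<in> closure (range U)"
    and "smul c b \<in> closure (range U)"
proof -
  interpret U: Vector_Spaces.linear s smul U by fact
  obtain w where w: "\<And>k. w k \<in> range U" "w \<longlonglongrightarrow> b" using assms(2) closure_sequential by blast
  have "smul c (w k) \<in> range U" for k using w(1)[of k] by (auto simp flip: U.scale)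
  moreover have "(\<lambda>k. smul c (w k)) \<longlonglongrightarrow> smul c b" by (intro tendsto_smul tendsto_const w)
  ultimately show "smul c b \<in> closure (range U)" by (rule limit_in_closure)
  assume "b' \<in> closure (range U)"
  then obtain w' where w': "\<And>k. w' k \<in> range U" "w' \<longlonglongrightarrow> b'" using closure_sequential by blast
  have "w k + w' k \<in> range U" for k
  proof -
    obtain x y where "w k = U x" "w' k = U y" using w(1)[of k] w'(1)[of k] by blast
    then show ?thesis by (metis U.add rangeI)
  qed
  moreover have "(\<lambda>k. w k + w' k) \<longlonglongrightarrow> b + b'" by (intro tendsto_add w w')
  ultimately show "b + b' \<in> closure (range U)" by (rule limit_in_closure)
qed

text \<open>
  The difference lies in the closure of the range of \<open>U\<close> and is orthogonal to that range, hence to itself.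
\<close>

lemma closure_range_eqI:
  fixes s :: "'k \<Rightarrow> 'b::ab_group_add \<Rightarrow> 'b"
  assumes U: "Vector_Spaces.linear s smul U" and b: "b \<in> closure (range U)" "b' \<in> closure (range U)"
    and eq: "\<And>x. ip (U x) b = ip (U x) b'"
  shows "b = b'"
proof -
  have "b + smul (-1) b' \<in> closure (range U)" using closure_range_linear[OF U] b by blast
  then have "b - b' \<in> closure (range U)" by simp
  then obtain w where w: "\<And>k. w k \<in> range U" "w \<longlonglongrightarrow> b - b'"
    unfolding closure_sequential by blast
  have "ip (w k) (b - b') = 0" for k using w(1)[of k] eq by (auto simp: ip_diff_right)
  moreover have "(\<lambda>k. ip (w k) (b - b')) \<longlonglongrightarrow> ip (b - b') (b - b')"
    by (intro tendsto_ip tendsto_const w)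
  ultimately have "ip (b - b') (b - b') = 0" by (simp add: LIMSEQ_const_iff)
  then show ?thesis by (simp add: ip_self)
qed

text \<open>
  In terms of adjoints the hypothesis \<open>bound\<close> reads \<open>\<parallel>L\<^sup>* x\<parallel> \<le> C \<parallel>U x\<parallel>\<close> and the conclusion \<open>L = U\<^sup>* V\<close>. The choice of
  \<open>V y\<close> in the closure of the range of \<open>U\<close>, where representing vectors are unique, is what makes \<open>V\<close>
  linear.
\<close>

lemma douglas_factorization:
  fixes sH :: "'k \<Rightarrow> 'b::banach \<Rightarrow> 'b" and ipH :: "'b \<Rightarrow> 'b \<Rightarrow> 'k"
  assumes "hilbert_space sH ipH"
    and U: "Vector_Spaces.linear sH smul U" and "Vector_Spaces.linear sH sH L"
    and bound: "\<And>x y. norm (ipH x (L y)) \<le> C * norm y * norm (U x)" and "0 \<le> C"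
  obtains V where "Vector_Spaces.linear sH smul V"
    "\<And>x y. ipH x (L y) = ip (U x) (V y)" "\<And>y. norm (V y) \<le> C * norm y"
proof -
  interpret H: hilbert_space sH ipH by fact
  interpret L: Vector_Spaces.linear sH sH L by fact
  have "\<exists>b. b \<in> closure (range U) \<and> (\<forall>x. ipH x (L y) = ip (U x) b) \<and> norm b \<le> C * norm y" for y
    using riesz_through[OF U H.linear_ip_left[of "L y"], of "C * norm y"] bound \<open>0 \<le> C\<close>
    by (metis mult_nonneg_nonneg norm_ge_zero)
  then obtain V where V: "\<And>y. V y \<in> closure (range U)" "\<And>x y. ipH x (L y) = ip (U x) (V y)"
    "\<And>y. norm (V y) \<le> C * norm y" by metis
  have "V (x + y) = V x + V y" for x y
    by (rule closure_range_eqI[OF U V(1) closure_range_linear(1)[OF U V(1) V(1)]])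
      (simp add: ip_add_right V(2)[symmetric] L.add H.ip_add_right)
  moreover have "V (sH c x) = smul c (V x)" for c x
    by (rule closure_range_eqI[OF U V(1) closure_range_linear(2)[OF U V(1)]])
      (simp add: ip_scale_right V(2)[symmetric] L.scale H.ip_scale_right)
  ultimately have "Vector_Spaces.linear sH smul V"
    unfolding Vector_Spaces.linear_iff by (intro conjI allI H.vector_space_axioms vector_space_axioms)
  then show thesis using V(2,3) that by blast
qed

section \<open>Atomic systems for an operator\<close>

text \<open>
  The factorization \<open>L = U\<^sup>* V\<close> read in coordinates: \<open>g\<^sub>n\<close> is the Riesz vector of the \<open>n\<close>-th coordinate of
  \<open>V\<close>.
\<close>

lemma bounded_operator_expansion_if_adjoint_bound:
  assumes L: "bounded_operator smul L" and f: "bessel_sequence ip f"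
    and "0 < A" and lower: "\<And>x. A * (norm (hilbert_adjoint ip L x))\<^sup>2 \<le> (\<Sum>n. (norm (ip x (f n)))\<^sup>2)"
  obtains g where "bessel_sequence ip g" "\<And>x. (\<lambda>n. smul (ip x (g n)) (f n)) sums L x"
proof -
  define M where "M = hilbert_adjoint ip L"
  have f_l2: "(\<lambda>n. ip x (f n)) \<in> l2" for x using f unfolding bessel_sequence_iff by blast
  define U where "U x = Abs_ell2 (\<lambda>n. ip x (f n))" for x
  have coeff_U: "coeff (U x) = (\<lambda>n. ip x (f n))" for x
    unfolding U_def by (rule Abs_ell2_inverse[OF f_l2])
  have linU: "Vector_Spaces.linear smul smul_ell2 U"
    unfolding Vector_Spaces.linear_iff
    by (intro conjI allI vector_space_axioms ell2.vector_space_axioms ell2_eqI)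
      (simp_all add: coeff_U ip_add_left ip_scale_left)
  have linL: "Vector_Spaces.linear smul smul L" using L by (simp add: bounded_operator_def)
  define C where "C = 1 / sqrt A"
  have C: "0 \<le> C" using \<open>0 < A\<close> by (simp add: C_def)
  have M_le: "norm (M x) \<le> C * norm (U x)" for x
  proof -
    have "sqrt (A * (norm (M x))\<^sup>2) \<le> norm (U x)"
      using real_sqrt_le_mono[OF lower[of x]] by (simp add: M_def norm_ell2_def coeff_U l2_norm_def)
    then show ?thesis using \<open>0 < A\<close> by (simp add: C_def real_sqrt_mult field_simps)
  qed
  have "norm (ip x (L y)) \<le> C * norm y * norm (U x)" for x y
  proof -
    have "norm (ip x (L y)) = norm (ip y (M x))"
      unfolding M_def hilbert_adjoint[OF L, symmetric] by (metis ip_commute norm_cj)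
    also have "\<dots> \<le> norm y * (C * norm (U x))"
      using cauchy_schwarz[of y "M x"] mult_left_mono[OF M_le norm_ge_zero[of y]] by (rule order_trans)
    finally show ?thesis by (simp add: mult_ac)
  qed
  then obtain V where V: "Vector_Spaces.linear smul smul_ell2 V"
    "\<And>x y. ip x (L y) = ip_ell2 (U x) (V y)" "\<And>y. norm (V y) \<le> C * norm y"
    using ell2.douglas_factorization[OF hilbert_space_axioms linU linL _ C] by blast
  interpret V: Vector_Spaces.linear smul smul_ell2 V by (rule V(1))
  have "\<exists>b. \<forall>x. coeff (V x) n = ip x b" for n
  proof -
    have "Vector_Spaces.linear smul (*) (\<lambda>x. coeff (V x) n)"
      by unfold_locales (auto simp: V.add V.scale algebra_simps)
    moreover have "norm (coeff (V x) n) \<le> C * norm x" for x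
      using norm_coeff_le V(3) by (rule order_trans)
    ultimately show ?thesis using riesz_representation C by metis
  qed
  then obtain g where g: "\<And>x n. coeff (V x) n = ip x (g n)" by metis
  have coeff_V: "coeff (V x) = (\<lambda>n. ip x (g n))" for x using g by blast
  have g_l2: "(\<lambda>n. ip x (g n)) \<in> l2" for x using coeff_in_l2[of "V x"] by (simp add: coeff_V)
  have "l2_norm (\<lambda>n. ip x (g n)) \<le> C * norm x" for x
    using V(3)[of x] by (simp add: norm_ell2_def coeff_V)
  then have "bessel_sequence ip g" unfolding bessel_sequence_iff using g_l2 C by blast
  moreover have "(\<lambda>n. smul (ip y (g n)) (f n)) sums L y" for y
  proof -
    obtain z where z: "(\<lambda>n. smul (ip y (g n)) (f n)) sums z"
      using synthesis_summable[OF f g_l2] summable_sums by blast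
    have "ip x z = ip x (L y)" for x
    proof (rule sums_unique2)
      show "(\<lambda>n. ip x (smul (ip y (g n)) (f n))) sums ip x z" by (rule sums_ip_right[OF z])
      show "(\<lambda>n. ip x (smul (ip y (g n)) (f n))) sums ip x (L y)"
        using ip_ell2_sums[of "U x" "V y"]
        by (simp add: V(2) coeff_U coeff_V ip_scale_right mult.commute)
    qed
    then show ?thesis using z eq_if_ip_eq by metis
  qed
  ultimately show thesis using that by blast
qed

text \<open>
  With \<open>y = L\<^sup>* x\<close> and coefficients \<open>a\<close> of \<open>L y\<close>, the square \<open>\<parallel>y\<parallel>\<^sup>2 = \<langle>L y, x\<rangle>\<close> is the \<open>\<ell>\<^sup>2\<close> inner product of
  \<open>a\<close> with the analysis coefficients of \<open>x\<close>. Its Cauchy-Schwarz bound contains a factor \<open>\<parallel>y\<parallel>\<close> that cancels.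
\<close>

lemma adjoint_bound_if_atomic_system:
  assumes L: "bounded_operator smul L" and "\<And>x. (\<lambda>n. ip x (f n)) \<in> l2" and "0 < C"
    and coefficients: "\<And>x. \<exists>a\<in>l2. l2_norm a \<le> C * norm x \<and> (\<lambda>n. smul (a n) (f n)) sums L x"
  shows "norm (hilbert_adjoint ip L x) \<le> C * l2_norm (\<lambda>n. ip x (f n))"
proof -
  define y where "y = hilbert_adjoint ip L x"
  obtain a where a: "a \<in> l2" "l2_norm a \<le> C * norm y" "(\<lambda>n. smul (a n) (f n)) sums L y"
    using coefficients by blast
  obtain d where d: "coeff d = a" using Abs_ell2_inverse[OF a(1)] by blast
  obtain e where e: "coeff e = (\<lambda>n. ip x (f n))" using Abs_ell2_inverse[OF assms(2)] by blast
  have "ip (L y) x = ip_ell2 d e"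
  proof (rule sums_unique2)
    show "(\<lambda>n. ip (smul (a n) (f n)) x) sums ip (L y) x" by (rule sums_ip_left[OF a(3)])
    show "(\<lambda>n. ip (smul (a n) (f n)) x) sums ip_ell2 d e"
      using ip_ell2_sums[of d e] by (simp add: d e ip_scale_left ip_commute[symmetric])
  qed
  then have "ip_ell2 d e = of_real ((norm y)\<^sup>2)"
    unfolding ip_self[symmetric] by (simp add: y_def hilbert_adjoint[OF L])
  then have "norm y * norm y \<le> norm d * norm e"
    using ell2.cauchy_schwarz[of d e] by (simp add: power2_eq_square norm_mult)
  also have "\<dots> \<le> (C * norm y) * norm e"
    using a(2) by (intro mult_right_mono norm_ge_zero) (simp add: norm_ell2_def d)
  finally have *: "norm y * norm y \<le> (C * norm e) * norm y" by (simp add: mult_ac)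
  have "norm y \<le> C * norm e"
  proof (cases "y = 0")
    case True
    then show ?thesis using \<open>0 < C\<close> by simp
  next
    case False
    then show ?thesis using * by simp
  qed
  then show ?thesis by (simp add: y_def norm_ell2_def e)
qed

end

theorem theorem3:
  fixes smul :: "'k::conj_field \<Rightarrow> 'a::banach \<Rightarrow> 'a"
    and ip :: "'a \<Rightarrow> 'a \<Rightarrow> 'k"
    and L :: "'a \<Rightarrow> 'a"
    and f :: "nat \<Rightarrow> 'a"
  assumes "hilbert_space smul ip"
    and "separable_space (euclidean :: 'a topology)"
    and "bounded_operator smul L"
  shows "(atomic_system smul L f \<longleftrightarrow>
          (\<exists>A>0. \<exists>B>0. \<forall>x.
             summable (\<lambda>n. (norm (ip x (f n)))\<^sup>2) \<and>
             A * (norm (hilbert_adjoint ip L x))\<^sup>2 \<le> (\<Sum>n. (norm (ip x (f n)))\<^sup>2) \<and>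
             (\<Sum>n. (norm (ip x (f n)))\<^sup>2) \<le> B * (norm x)\<^sup>2)) \<and>
         (atomic_system smul L f \<longleftrightarrow>
          bessel_sequence ip f \<and>
          (\<exists>g. bessel_sequence ip g \<and> (\<forall>x. (\<lambda>n. smul (ip x (g n)) (f n)) sums L x))) \<and>
         (atomic_system smul L f \<longleftrightarrow>
          (\<forall>x. summable (\<lambda>n. (norm (ip x (f n)))\<^sup>2)) \<and>
          (\<exists>g. bessel_sequence ip g \<and>
               (\<forall>x. (\<lambda>n. smul (ip x (f n)) (g n)) sums hilbert_adjoint ip L x)))"
    (is "(?i \<longleftrightarrow> ?ii) \<and> (?i \<longleftrightarrow> ?iii) \<and> (?i \<longleftrightarrow> ?iv)")
proof -
  interpret hilbert_space smul ip by fact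
  note adj = hilbert_adjoint[OF assms(3)]
  have adj': "ip (hilbert_adjoint ip L x) y = ip x (L y)" for x y
    by (metis adj ip_commute)
  have i_ii: ?ii if ?i
  proof -
    from that obtain C where C: "0 < C"
      "\<And>x. \<exists>a\<in>l2. l2_norm a \<le> C * norm x \<and> (\<lambda>n. smul (a n) (f n)) sums L x"
      unfolding atomic_system_def by blast
    have f: "bessel_sequence ip f"
      using that unfolding atomic_system_def by (intro bessel_sequence_if_synthesis_summable) blast
    then obtain B where B: "0 < B" "\<And>x. summable (\<lambda>n. (norm (ip x (f n)))\<^sup>2)"
      "\<And>x. (\<Sum>n. (norm (ip x (f n)))\<^sup>2) \<le> B * (norm x)\<^sup>2"
      unfolding bessel_sequence_def by blast
    have f_l2: "(\<lambda>n. ip x (f n)) \<in> l2" for x using B(2) by (simp add: l2_def)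
    have "(1 / C\<^sup>2) * (norm (hilbert_adjoint ip L x))\<^sup>2 \<le> (\<Sum>n. (norm (ip x (f n)))\<^sup>2)" for x
    proof -
      have "(norm (hilbert_adjoint ip L x))\<^sup>2 \<le> (C * l2_norm (\<lambda>n. ip x (f n)))\<^sup>2"
        by (intro power_mono adjoint_bound_if_atomic_system assms(3) f_l2 C norm_ge_zero)
      then show ?thesis
        using C(1) by (simp add: power_mult_distrib l2_norm_square[OF f_l2] field_simps)
    qed
    moreover have "0 < 1 / C\<^sup>2" using C(1) by simp
    ultimately show ?ii using B by blast
  qed
  have ii_iii: ?iii if ?ii
  proof -
    from that obtain A B where AB: "0 < A" "0 < B" "\<And>x. summable (\<lambda>n. (norm (ip x (f n)))\<^sup>2)"
      "\<And>x. A * (norm (hilbert_adjoint ip L x))\<^sup>2 \<le> (\<Sum>n. (norm (ip x (f n)))\<^sup>2)"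
      "\<And>x. (\<Sum>n. (norm (ip x (f n)))\<^sup>2) \<le> B * (norm x)\<^sup>2" by blast
    then have f: "bessel_sequence ip f" unfolding bessel_sequence_def by blast
    then show ?iii
      using bounded_operator_expansion_if_adjoint_bound[OF assms(3) f AB(1,4)] by metis
  qed
  have iii_iv: ?iv if ?iii
  proof -
    from that obtain g where f: "bessel_sequence ip f" and g: "bessel_sequence ip g"
      "\<And>x. (\<lambda>n. smul (ip x (g n)) (f n)) sums L x" by blast
    have "\<And>x. summable (\<lambda>n. (norm (ip x (f n)))\<^sup>2)" using f unfolding bessel_sequence_def by blast
    with adjoint_expansion[OF g(2) adj f g(1)] show ?iv using g(1) by blast
  qed
  have iv_iii: ?iii if ?iv
  proof -
    from that obtain g where g: "bessel_sequence ip g"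
      "\<And>x. (\<lambda>n. smul (ip x (f n)) (g n)) sums hilbert_adjoint ip L x" by blast
    have f: "bessel_sequence ip f" using that by (intro bessel_sequence_if_pointwise) (simp add: l2_def)
    from adjoint_expansion[OF g(2) adj' g(1) f] show ?iii using f g(1) by blast
  qed
  have iii_i: ?i if ?iii
  proof -
    from that obtain g where f: "bessel_sequence ip f" and g: "bessel_sequence ip g"
      "\<And>x. (\<lambda>n. smul (ip x (g n)) (f n)) sums L x" by blast
    obtain K where K: "0 \<le> K" "\<And>x. (\<lambda>n. ip x (g n)) \<in> l2"
      "\<And>x. l2_norm (\<lambda>n. ip x (g n)) \<le> K * norm x"
      using g(1) unfolding bessel_sequence_iff by blast
    \<comment> \<open>an atomic system requires a positive constant, whereas \<open>K\<close> may be 0\<close>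
    have "l2_norm (\<lambda>n. ip x (g n)) \<le> (K + 1) * norm x" for x
      using order_trans[OF K(3)] by (simp add: distrib_right)
    then show ?i
      unfolding atomic_system_def using synthesis_summable[OF f] K(1,2) g(2)
      by (intro conjI ballI exI[of _ "K + 1"]) (auto intro!: bexI)
  qed
  show ?thesis using i_ii ii_iii iii_iv iv_iii iii_i by argo
qed

end
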